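(* Let $p$ be a rational number with $0<p\le \tfrac12$, and let $\mathcal{F}_3(p)$ be the convex polytope of probability mass functions $f$ on $\{0,1\}^3$ all of whose three one-dimensional marginals are Bernoulli with mean $p$. Write each $f$ as the vector $$\boldsymbol f=(f(0,0,0),\,f(1,0,0),\,f(0,1,0),\,f(1,1,0),\,f(0,0,1),\,f(1,0,1),\,f(0,1,1),\,f(1,1,1)).$$ (1) If $p\le \tfrac13$, the set of extremal points of $\mathcal{F}_3(p)$ is $\{\boldsymbol r_1,\dots,\boldsymbol r_6\}$, where $$\begin{aligned} \boldsymbol r_1&=(1-2p,\,0,\,0,\,p,\,p,\,0,\,0,\,0),\\ \boldsymbol r_2&=(1-2p,\,0,\,p,\,0,\,0,\,p,\,0,\,0),\\ \boldsymbol r_3&=(1-2p,\,p,\,0,\,0,\,0,\,0,\,p,\,0),\\ \boldsymbol r_4&=(1-\tfrac{3p}{2},\,0,\,0,\,\tfrac p2,\,0,\,\tfrac p2,\,\tfrac p2,\,0),\\ \boldsymbol r_5&=(1-p,\,0,\,0,\,0,\,0,\,0,\,0,\,p),\\ \boldsymbol r_6&=(1-3p,\,p,\,p,\,0,\,p,\,0,\,0,\,0). \end{aligned}$$ (2) If $\tfrac13<p\le\tfrac12$, the set of extremal points of $\mathcal{F}_3(p)$ is $\{\boldsymbol r_1,\dots,\boldsymbol r_9\}$, where $\boldsymbol r_1,\dots,\boldsymbol r_5$ are given by the same formulas as in (1) and $$\begin{aligned} \boldsymbol r_6&=(0,\,1-2p,\,1-2p,\,3p-1,\,p,\,0,\,0,\,0),\\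 \boldsymbol r_7&=(0,\,1-2p,\,p,\,0,\,1-2p,\,3p-1,\,0,\,0),\\ \boldsymbol r_8&=(0,\,p,\,1-2p,\,0,\,1-2p,\,0,\,3p-1,\,0),\\ \boldsymbol r_9&=(0,\,\tfrac{1-p}{2},\,\tfrac{1-p}{2},\,0,\,\tfrac{1-p}{2},\,0,\,0,\,\tfrac{3p-1}{2}). \end{aligned}$$ (The listed vectors need not be pairwise distinct: for $p=\tfrac12$ one has $\boldsymbol r_6=\boldsymbol r_1$, $\boldsymbol r_7=\boldsymbol r_2$, $\boldsymbol r_8=\boldsymbol r_3$.)
   Context: $\mathcal{F}_3(p)$ is the set of $\boldsymbol f\in\mathbb{R}^8$, indexed by $\boldsymbol x\in\{0,1\}^3$, with $f(\boldsymbol x)\ge 0$, $\sum_{\boldsymbol x} f(\boldsymbol x)=1$ and $\sum_{\boldsymbol x:\,x_k=1} f(\boldsymbol x)=p$ for $k=1,2,3$. It is a convex polytope; its extremal points are its extreme points (vertices) in the usual convex-geometric sense. *)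

theory Defs
  imports "HOL-Analysis.Analysis"
begin

text \<open>
  A point \<open>x\<close> of \<open>{0,1}\<^sup>3\<close> is a vector \<open>x :: bool ^ 3\<close>, where \<open>x $ k\<close> means
  \<open>x\<^sub>k = 1\<close>. A real function on \<open>{0,1}\<^sup>3\<close> is then a vector in \<open>real ^ (bool ^ 3)\<close>,
  an 8-dimensional Euclidean space.
\<close>

definition bernoulli_polytope :: "real \<Rightarrow> (real ^ (bool ^ 3)) set"
  where "bernoulli_polytope p =
    {f. (\<forall>x. 0 \<le> f $ x) \<and> (\<Sum>x\<in>UNIV. f $ x) = 1 \<and> (\<forall>k. (\<Sum>x | x $ k. f $ x) = p)}"

text \<open>
  \<open>cube_vec\<close> reads an 8-entry list in the order
  \<open>(0,0,0), (1,0,0), (0,1,0), (1,1,0), (0,0,1), (1,0,1), (0,1,1), (1,1,1)\<close>,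
  in which the first coordinate varies fastest.
\<close>

definition cube_vec :: "real list \<Rightarrow> real ^ (bool ^ 3)"
  where "cube_vec v = (\<chi> x. v ! (of_bool (x $ 1) + 2 * of_bool (x $ 2) + 4 * of_bool (x $ 3)))"

end

theory Submission
  imports Defs
begin

text \<open>
  An extreme point of a polytope of the form ``affine subspace intersected with the nonnegative
  orthant'' is a point of minimal support, and it is determined by that support. It thus suffices
  that each listed vector is the only point of the polytope supported within its own support, and
  that the support of every point of the polytope contains the support of some listed vector.
  Both are linear arithmetic in the eight entries.
\<close>

text \<open>If \<open>g\<close> in \<open>P\<close> differs from \<open>f\<close> and vanishes
  wherever \<open>f\<close> does, a small step from \<open>f\<close> directly away from
  \<open>g\<close> stays in \<open>P\<close>, so \<open>f\<close> lies strictly between two points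
  of \<open>P\<close>. Conversely, a zero of a proper convex combination of nonnegative vectors is a
  zero of both endpoints.\<close>

lemma extreme_point_of_nonneg_affine_iff:
  fixes A :: "(real ^ 'n) set"
  assumes "affine A"
  defines "P \<equiv> {f \<in> A. \<forall>x. 0 \<le> f $ x}"
  shows "f extreme_point_of P \<longleftrightarrow>
    f \<in> P \<and> (\<forall>g\<in>P. (\<forall>x. f $ x = 0 \<longrightarrow> g $ x = 0) \<longrightarrow> g = f)" (is "?L \<longleftrightarrow> ?R")
proof
  assume ext: ?L
  then have f: "f \<in> P"
    by (simp add: extreme_point_of_def)
  moreover have "g = f" if g: "g \<in> P" and supp: "\<forall>x. f $ x = 0 \<longrightarrow> g $ x = 0" for g
  proof (rule ccontr)
    assume "g \<noteq> f"
    \<comment> \<open>Coordinates where \<open>f\<close> vanishes do not move; the positive ones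
      stay positive for small \<open>t\<close> by continuity. As there are finitely many
      coordinates, one \<open>t\<close> then serves them all.\<close>
    have "\<forall>\<^sub>F t in at_right 0. 0 \<le> f $ x + t * (f $ x - g $ x)" for x
    proof (cases "f $ x = 0")
      case True
      then show ?thesis using supp by simp
    next
      case False
      then have "0 < f $ x"
        using f by (simp add: P_def order_less_le)
      moreover have "((\<lambda>t. f $ x + t * (f $ x - g $ x)) \<longlongrightarrow> f $ x + 0 * (f $ x - g $ x)) (at_right 0)"
        by (intro tendsto_intros)
      ultimately have "\<forall>\<^sub>F t in at_right 0. 0 < f $ x + t * (f $ x - g $ x)"
        by (intro order_tendstoD) auto
      then show ?thesis
        by (rule eventually_mono) simp
    qed
    then have "\<forall>\<^sub>F t in at_right 0. \<forall>x. 0 \<le> f $ x + t * (f $ x - g $ x)"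
      by (rule eventually_all_finite)
    moreover have "\<forall>\<^sub>F t in at_right (0::real). 0 < t"
      by (rule eventually_at_right_less)
    ultimately obtain t where t: "0 < t" "\<forall>x. 0 \<le> f $ x + t * (f $ x - g $ x)"
      by (metis (mono_tags, lifting) eventually_conj eventually_happens trivial_limit_at_right_real)
    \<comment> \<open>The point just beyond \<open>f\<close> on the ray from \<open>g\<close>
      through \<open>f\<close>. Its coefficients sum to 1, which keeps it in \<open>A\<close>;
      solving for \<open>f\<close> gives the weight \<open>t / (1 + t)\<close> of \<open>g\<close>
      below.\<close>
    define h where "h = (1 + t) *\<^sub>R f + (- t) *\<^sub>R g"
    have "h \<in> A"
      unfolding h_def using f g by (intro mem_affine[OF assms(1)]) (auto simp: P_def)
    then have h: "h \<in> P"
      using t by (simp add: P_def h_def algebra_simps)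
    have "f = (1 - t / (1 + t)) *\<^sub>R h + (t / (1 + t)) *\<^sub>R g"
    proof -
      have "1 + t \<noteq> 0"
        using t(1) by simp
      then show ?thesis
        by (simp add: h_def vec_eq_iff divide_simps)
    qed
    moreover have "h \<noteq> g"
    proof
      assume "h = g"
      then have "(1 + t) *\<^sub>R (g - f) = 0"
        by (simp add: h_def algebra_simps)
      with \<open>g \<noteq> f\<close> t(1) show False by simp
    qed
    ultimately have "f \<in> open_segment h g"
      using t(1) unfolding in_segment by (intro conjI exI[of _ "t / (1 + t)"]) auto
    with ext h g show False
      by (auto simp: extreme_point_of_def)
  qed
  ultimately show ?R by blast
next
  assume R: ?R
  have "f \<notin> open_segment a b" if a: "a \<in> P" and b: "b \<in> P" for a b
  proof
    assume "f \<in> open_segment a b"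
    then obtain u where "a \<noteq> b" and u: "0 < u" "u < 1" and f: "f = (1 - u) *\<^sub>R a + u *\<^sub>R b"
      unfolding in_segment by blast
    have "a $ x = 0 \<and> b $ x = 0" if "f $ x = 0" for x
    proof -
      have "(1 - u) * a $ x + u * b $ x = 0"
        using that f by simp
      moreover have "0 \<le> (1 - u) * a $ x" "0 \<le> u * b $ x"
        using a b u by (auto simp: P_def)
      ultimately have "(1 - u) * a $ x = 0" "u * b $ x = 0"
        by linarith+
      then show ?thesis using u by auto
    qed
    then have "a = f" "b = f"
      using R a b by blast+
    with \<open>a \<noteq> b\<close> show False by simp
  qed
  with R show ?L
    by (auto simp: extreme_point_of_def)
qed

lemma extreme_point_of_bernoulli_polytope_iff:
  "f extreme_point_of bernoulli_polytope p \<longleftrightarrow>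
    f \<in> bernoulli_polytope p \<and>
    (\<forall>g\<in>bernoulli_polytope p. (\<forall>x. f $ x = 0 \<longrightarrow> g $ x = 0) \<longrightarrow> g = f)"
proof -
  define A :: "(real ^ (bool ^ 3)) set"
    where "A = {f. (\<Sum>x\<in>UNIV. f $ x) = 1 \<and> (\<forall>k. (\<Sum>x | x $ k. f $ x) = p)}"
  have "affine A"
    unfolding affine_def A_def
    by (auto simp: sum.distrib simp flip: sum_distrib_left distrib_right)
  moreover have "bernoulli_polytope p = {f \<in> A. \<forall>x. 0 \<le> f $ x}"
    by (auto simp: bernoulli_polytope_def A_def)
  ultimately show ?thesis
    using extreme_point_of_nonneg_affine_iff[of A f] by simp
qed

text \<open>For an extreme \<open>f\<close>, the third assumption yields some \<open>r\<close> in
  \<open>L\<close> supported within the support of \<open>f\<close>, and the support criterion for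
  \<open>f\<close> forces \<open>r = f\<close>. The first two assumptions are that same criterion
  for the members of \<open>L\<close>.\<close>

lemma extreme_points_of_bernoulli_polytope_eqI:
  assumes "\<And>r. r \<in> L \<Longrightarrow> r \<in> bernoulli_polytope p"
    and "\<And>r g. r \<in> L \<Longrightarrow> g \<in> bernoulli_polytope p \<Longrightarrow> \<forall>x. r $ x = 0 \<longrightarrow> g $ x = 0 \<Longrightarrow> g = r"
    and "\<And>f. f \<in> bernoulli_polytope p \<Longrightarrow> \<exists>r\<in>L. \<forall>x. f $ x = 0 \<longrightarrow> r $ x = 0"
  shows "{f. f extreme_point_of bernoulli_polytope p} = L"
  unfolding extreme_point_of_bernoulli_polytope_iff using assms by blast

text \<open>Triples let a quantifier or sum over \<open>bool ^ 3\<close> split into three over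
  \<open>bool\<close>, hence into eight explicit cases.\<close>

definition cube_point :: "bool \<times> bool \<times> bool \<Rightarrow> bool ^ 3"
  where "cube_point = (\<lambda>(a, b, c). \<chi> i. if i = 1 then a else if i = 2 then b else c)"

lemma bij_cube_point: "bij cube_point"
proof (rule o_bij)
  show "(\<lambda>x. (x $ 1, x $ 2, x $ 3)) \<circ> cube_point = id"
    by (auto simp: cube_point_def)
  show "cube_point \<circ> (\<lambda>x. (x $ 1, x $ 2, x $ 3)) = id"
    by (auto simp: fun_eq_iff cube_point_def vec_eq_iff forall_3)
qed

lemma all_cube_iff: "(\<forall>x. Q x) \<longleftrightarrow> (\<forall>a b c. Q (cube_point (a, b, c)))"
  using bij_is_surj[OF bij_cube_point] by (metis prod_cases3 surj_def)

lemma sum_cube: "(\<Sum>x\<in>UNIV. F x) = (\<Sum>a\<in>UNIV. \<Sum>b\<in>UNIV. \<Sum>c\<in>UNIV. F (cube_point (a, b, c)))"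
  by (simp add: sum.reindex_bij_betw[OF bij_cube_point, symmetric] sum.cartesian_product
      flip: UNIV_Times_UNIV)

lemma cube_vec_cube_point [simp]:
  "cube_vec v $ cube_point (a, b, c) = v ! (of_bool a + 2 * of_bool b + 4 * of_bool c)"
  by (simp add: cube_vec_def cube_point_def)

lemma cube_point_nth [simp]:
  "cube_point (a, b, c) $ 1 = a" "cube_point (a, b, c) $ 2 = b" "cube_point (a, b, c) $ 3 = c"
  by (simp_all add: cube_point_def)

text \<open>Trades an arbitrary vector for eight real variables, so that the later goals become
  linear arithmetic. The letter \<open>f\<close> is skipped because it names the vector.\<close>

lemma cube_vec_cases:
  obtains a b c d e g h i where "f = cube_vec [a, b, c, d, e, g, h, i]"
proof
  let ?f = "\<lambda>a b c. f $ cube_point (a, b, c)"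
  show "f = cube_vec [?f False False False, ?f True False False, ?f False True False,
    ?f True True False, ?f False False True, ?f True False True, ?f False True True,
    ?f True True True]"
    unfolding vec_eq_iff all_cube_iff[where Q = "\<lambda>x. _ $ x = _ $ x"] all_bool_eq by simp
qed

lemma cube_vec_eq_iff:
  "cube_vec [a, b, c, d, e, g, h, i] = cube_vec [a', b', c', d', e', g', h', i'] \<longleftrightarrow>
    a = a' \<and> b = b' \<and> c = c' \<and> d = d' \<and> e = e' \<and> g = g' \<and> h = h' \<and> i = i'"
  unfolding vec_eq_iff all_cube_iff[where Q = "\<lambda>x. _ $ x = _ $ x"] all_bool_eq by auto

lemma cube_vec_support_iff:
  "(\<forall>x. cube_vec [a, b, c, d, e, g, h, i] $ x = 0 \<longrightarrow>
      cube_vec [a', b', c', d', e', g', h', i'] $ x = 0) \<longleftrightarrow>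
    (a = 0 \<longrightarrow> a' = 0) \<and> (b = 0 \<longrightarrow> b' = 0) \<and> (c = 0 \<longrightarrow> c' = 0) \<and> (d = 0 \<longrightarrow> d' = 0) \<and>
    (e = 0 \<longrightarrow> e' = 0) \<and> (g = 0 \<longrightarrow> g' = 0) \<and> (h = 0 \<longrightarrow> h' = 0) \<and> (i = 0 \<longrightarrow> i' = 0)"
  unfolding all_cube_iff[where Q = "\<lambda>x. _ $ x = _ \<longrightarrow> _ $ x = _"] all_bool_eq by auto

text \<open>The entries \<open>b\<close>, \<open>c\<close>, \<open>e\<close> sit at the points with
  a single 1, \<open>d\<close>, \<open>g\<close>, \<open>h\<close> at those with two, and
  \<open>i\<close> at (1,1,1). Adding the three marginal equations and subtracting the total gives d
  + g + h + 2i = 3p - 1 + a, the identity behind the case splits on \<open>a\<close> in the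
  theorem.\<close>

lemma cube_vec_mem_bernoulli_polytope_iff:
  "cube_vec [a, b, c, d, e, g, h, i] \<in> bernoulli_polytope p \<longleftrightarrow>
    0 \<le> a \<and> 0 \<le> b \<and> 0 \<le> c \<and> 0 \<le> d \<and> 0 \<le> e \<and> 0 \<le> g \<and> 0 \<le> h \<and> 0 \<le> i \<and>
    a + b + c + d + e + g + h + i = 1 \<and>
    b + d + g + i = p \<and> c + d + h + i = p \<and> e + g + h + i = p"
proof -
  \<comment> \<open>Makes the marginal a sum over the whole cube, to which \<open>sum_cube\<close>
    applies.\<close>
  have "(\<Sum>x | x $ k. f $ x) = (\<Sum>x\<in>UNIV. if x $ k then f $ x else 0)"
    for k and f :: "real ^ (bool ^ 3)"
    by (simp add: sum.If_cases)
  then show ?thesis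
    unfolding bernoulli_polytope_def mem_Collect_eq
      all_cube_iff[where Q = "\<lambda>x. _ \<le> _ $ x"] all_bool_eq forall_3
    by (simp add: sum_cube UNIV_bool) argo
qed

theorem theorem2p1:
  fixes p :: real
  assumes "p \<in> \<rat>" and "0 < p" and "p \<le> 1/2"
  shows "(p \<le> 1/3 \<longrightarrow>
      {f. f extreme_point_of bernoulli_polytope p} =
        {cube_vec [1 - 2*p, 0, 0, p, p, 0, 0, 0],
         cube_vec [1 - 2*p, 0, p, 0, 0, p, 0, 0],
         cube_vec [1 - 2*p, p, 0, 0, 0, 0, p, 0],
         cube_vec [1 - 3*p/2, 0, 0, p/2, 0, p/2, p/2, 0],
         cube_vec [1 - p, 0, 0, 0, 0, 0, 0, p],
         cube_vec [1 - 3*p, p, p, 0, p, 0, 0, 0]}) \<and>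
    (1/3 < p \<longrightarrow>
      {f. f extreme_point_of bernoulli_polytope p} =
        {cube_vec [1 - 2*p, 0, 0, p, p, 0, 0, 0],
         cube_vec [1 - 2*p, 0, p, 0, 0, p, 0, 0],
         cube_vec [1 - 2*p, p, 0, 0, 0, 0, p, 0],
         cube_vec [1 - 3*p/2, 0, 0, p/2, 0, p/2, p/2, 0],
         cube_vec [1 - p, 0, 0, 0, 0, 0, 0, p],
         cube_vec [0, 1 - 2*p, 1 - 2*p, 3*p - 1, p, 0, 0, 0],
         cube_vec [0, 1 - 2*p, p, 0, 1 - 2*p, 3*p - 1, 0, 0],
         cube_vec [0, p, 1 - 2*p, 0, 1 - 2*p, 0, 3*p - 1, 0],
         cube_vec [0, (1 - p)/2, (1 - p)/2, 0, (1 - p)/2, 0, 0, (3*p - 1)/2]})"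
proof -
  note iffs = cube_vec_mem_bernoulli_polytope_iff cube_vec_eq_iff cube_vec_support_iff
  show ?thesis
  proof (intro conjI impI)
    assume "p \<le> 1/3"
    show "{f. f extreme_point_of bernoulli_polytope p} =
        {cube_vec [1 - 2*p, 0, 0, p, p, 0, 0, 0],
         cube_vec [1 - 2*p, 0, p, 0, 0, p, 0, 0],
         cube_vec [1 - 2*p, p, 0, 0, 0, 0, p, 0],
         cube_vec [1 - 3*p/2, 0, 0, p/2, 0, p/2, p/2, 0],
         cube_vec [1 - p, 0, 0, 0, 0, 0, 0, p],
         cube_vec [1 - 3*p, p, p, 0, p, 0, 0, 0]}" (is "_ = ?L")
    proof (rule extreme_points_of_bernoulli_polytope_eqI)
      show "r \<in> bernoulli_polytope p" if "r \<in> ?L" for r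
        using that assms \<open>p \<le> 1/3\<close> by (auto simp: iffs)
      \<comment> \<open>Once the entries outside the support of \<open>r\<close> are 0, the four
        linear equations have only one solution.\<close>
      show "g = r" if "r \<in> ?L" "g \<in> bernoulli_polytope p" "\<forall>x. r $ x = 0 \<longrightarrow> g $ x = 0" for r g
        using that by (cases g rule: cube_vec_cases) (auto simp: iffs)
      show "\<exists>r\<in>?L. \<forall>x. f $ x = 0 \<longrightarrow> r $ x = 0" if "f \<in> bernoulli_polytope p" for f
      proof (cases f rule: cube_vec_cases)
        case (1 a b c d e g h i)
        note f = that[unfolded 1 iffs]
        show ?thesis
        proof (cases "a = 0")
          case True
          \<comment> \<open>Here d + g + h + 2i = 3p - 1 is at most 0, so p = 1/3 and
            \<open>f\<close> is the sixth vector, whose first entry 1 - 3p vanishes.\<close>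
          then have "b = p \<and> c = p \<and> e = p \<and> 1 = 3 * p"
            using f \<open>p \<le> 1/3\<close> by linarith
          then show ?thesis
            unfolding 1 bex_simps iffs by simp
        next
          case False
          \<comment> \<open>If i > 0, the fifth vector fits. If i = 0 and both entries of a
            complementary pair (d,e), (c,g) or (b,h) are positive, one of the first three fits.
            Otherwise either b, c, e are all positive (sixth vector), or one of them is 0 and the
            marginals force d = g = h = p/2 (fourth vector).\<close>
          then show ?thesis
            using f \<open>0 < p\<close> unfolding 1 bex_simps iffs by simp (smt (verit))
        qed
      qed
    qed
  next
    assume "1/3 < p"
    show "{f. f extreme_point_of bernoulli_polytope p} =
        {cube_vec [1 - 2*p, 0, 0, p, p, 0, 0, 0],
         cube_vec [1 - 2*p, 0, p, 0, 0, p, 0, 0],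
         cube_vec [1 - 2*p, p, 0, 0, 0, 0, p, 0],
         cube_vec [1 - 3*p/2, 0, 0, p/2, 0, p/2, p/2, 0],
         cube_vec [1 - p, 0, 0, 0, 0, 0, 0, p],
         cube_vec [0, 1 - 2*p, 1 - 2*p, 3*p - 1, p, 0, 0, 0],
         cube_vec [0, 1 - 2*p, p, 0, 1 - 2*p, 3*p - 1, 0, 0],
         cube_vec [0, p, 1 - 2*p, 0, 1 - 2*p, 0, 3*p - 1, 0],
         cube_vec [0, (1 - p)/2, (1 - p)/2, 0, (1 - p)/2, 0, 0, (3*p - 1)/2]}" (is "_ = ?L")
    proof (rule extreme_points_of_bernoulli_polytope_eqI)
      show "r \<in> bernoulli_polytope p" if "r \<in> ?L" for r
        using that assms \<open>1/3 < p\<close> by (auto simp: iffs field_simps)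
      show "g = r" if "r \<in> ?L" "g \<in> bernoulli_polytope p" "\<forall>x. r $ x = 0 \<longrightarrow> g $ x = 0" for r g
        using that \<open>1/3 < p\<close> by (cases g rule: cube_vec_cases) (auto simp: iffs)
      show "\<exists>r\<in>?L. \<forall>x. f $ x = 0 \<longrightarrow> r $ x = 0" if "f \<in> bernoulli_polytope p" for f
      proof (cases f rule: cube_vec_cases)
        case (1 a b c d e g h i)
        note f = that[unfolded 1 iffs]
        show ?thesis
        proof (cases "a = 0")
          case True
          \<comment> \<open>Since a = 0, the equations give e = 1 - 2p + d + i, c = 1 - 2p + g + i
            and b = 1 - 2p + h + i. As d + g + h + 2i = 3p - 1 > 0, one of d, g, h, i is positive
            and selects one of the last four vectors. For p = 1/2 the entries 1 - 2p of these
            vectors vanish, so the supports still fit.\<close>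
          then show ?thesis
            using f \<open>1/3 < p\<close> \<open>p \<le> 1/2\<close> unfolding 1 bex_simps iffs by simp (smt (verit))
        next
          case False
          \<comment> \<open>As for p at most 1/3 with a > 0, except that d + g + h + 2i = 3p - 1 + a
            > 0 excludes d = g = h = i = 0, so the first five vectors suffice.\<close>
          then show ?thesis
            using f \<open>1/3 < p\<close> unfolding 1 bex_simps iffs by simp (smt (verit))
        qed
      qed
    qed
  qed
qed

end
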